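(* Consider the scalar linear interconnected multi-agent system $$x_i^+=a x_i+\sum_{j\in\mathcal{N}_i^p}a_{ij}(x_j-x_i)+u_i,\qquad u_i=k\sum_{j\in\mathcal{N}_i^c}b_{ij}(x_i-x_j),\qquad i=1,\dots,N,$$ with $x_i,u_i,a,k\in\mathbb{R}$, as set up in the context. It is consensusable if either of the following conditions holds: (S1) $\lambda_{p,\min}>a-1$ and $(\gamma_c-1)(1-a+\lambda_{p,\min})<\gamma_c(2-\Delta_p)$; (S2) $\lambda_{p,\max}<1+a$ and $(\gamma_c-1)(1+a-\lambda_{p,\max})<\gamma_c(2-\Delta_p)$. Moreover, the control gain $k$ (achieving consensus) can be selected as $k\in\mathbb{K}^+\cap\mathbb{R}_{\ge0}$ if (S1) is satisfied, and as $k\in\mathbb{K}^-\cap\mathbb{R}_{<0}$ if (S2) is satisfied, where $\mathbb{K}^+$ and $\mathbb{K}^-$ are the open intervals $$\mathbb{K}^+=\left(\frac{-1-a+\lambda_{p,\max}}{\lambda_{c,\min}},\frac{1-a+\lambda_{p,\min}}{\lambda_{c,\max}}\right),\qquad \mathbb{K}^-=\left(\frac{-1-a+\lambda_{p,\max}}{\lambda_{c,\max}},\frac{1-a+\lambda_{p,\min}}{\lambda_{c,\min}}\right).$$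
   Context: Let $N\ge2$. The physical graph $\mathcal{G}_p$ and the communication graph $\mathcal{G}_c$ are undirected weighted graphs on the common node set $\{1,\dots,N\}$, with symmetric positive edge weights $a_{ij}=a_{ji}>0$ and $b_{ij}=b_{ji}>0$ and neighbor sets $\mathcal{N}_i^p$ and $\mathcal{N}_i^c$, respectively. $\mathcal{G}_c$ is connected; $\mathcal{G}_p$ may be disconnected. Their Laplacians (degree matrix minus weighted adjacency matrix) are $\mathcal{L}_p$ and $\mathcal{L}_c$. The system is in discrete time ($x^+$ denotes the next value of $x$) and its closed loop is $x^+=(aI_N-\mathcal{L}_p+k\mathcal{L}_c)x$ with $x=[x_1,\dots,x_N]^\top$. A gain $k\in\mathbb{R}$ achieves consensus if the states of all subsystems converge to a global consensus value, i.e. $\lim_{t\to\infty}|x_i(t)-\bar v|=0$ for all $i\in\{1,\dots,N\}$, for some $\bar v\in\mathbb{R}$. The system is consensusable if some $k\in\mathbb{R}$ achieves consensus. Let $\lambda_{p,2},\dots,\lambda_{p,N}$ (resp. $\lambda_{c,2},\dots,\lambda_{c,N}$) be the eigenvalues, with multiplicity, of $\mathcal{L}_p$ (resp. $\mathcal{L}_c$) restricted to the invariant subspace $\{v\in\mathbb{R}^N:\sum_i v_i=0\}$, i.e. all eigenvalues except the zero eigenvalue associated with the all-ones vector. Let $\lambda_{p,\max},\lambda_{p,\min},\lambda_{c,\max},\lambda_{c,\min}$ be the maximum and minimum over $i\in\{2,\dots,N\}$ of $\lambda_{p,i}$ and $\lambda_{c,i}$ respectively. Let $\gamma_c=\lambda_{c,\max}/\lambda_{c,\min}$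 and $\Delta_p=\lambda_{p,\max}-\lambda_{p,\min}$.
   Formalization: Convergence to a constant value v̄ is claimed only for −1<a≤1 (it fails for every other a, since the average evolves as a^t); for general a, consensus means that all states approach a common, possibly time-varying, value v(t). *)

theory Defs
  imports "HOL-Analysis.Analysis"
begin

text \<open>Undirected weighted graphs whose nodes are the elements of a finite type \<open>'n\<close>;
  weights are only meaningful on edges.\<close>

record 'n wgraph =
  edge :: "'n \<Rightarrow> 'n \<Rightarrow> bool"
  weight :: "'n \<Rightarrow> 'n \<Rightarrow> real"

definition undirected_wgraph :: "'n wgraph \<Rightarrow> bool" where
  "undirected_wgraph G \<longleftrightarrow>
     (\<forall>i. \<not> edge G i i) \<and>
     (\<forall>i j. edge G i j \<longrightarrow> edge G j i \<and> weight G i j = weight G j i \<and> weight G i j > 0)"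

definition connected_wgraph :: "'n wgraph \<Rightarrow> bool" where
  "connected_wgraph G \<longleftrightarrow> (\<forall>i j. (edge G)\<^sup>*\<^sup>* i j)"

definition nbrs :: "'n wgraph \<Rightarrow> 'n \<Rightarrow> 'n set" where
  "nbrs G i = {j. edge G i j}"

definition adjacency_matrix :: "'n::finite wgraph \<Rightarrow> real^'n^'n" where
  "adjacency_matrix G = (\<chi> i j. if edge G i j then weight G i j else 0)"

definition degree_matrix :: "'n::finite wgraph \<Rightarrow> real^'n^'n" where
  "degree_matrix G = (\<chi> i j. if i = j then (\<Sum>l\<in>nbrs G i. weight G i l) else 0)"

definition laplacian :: "'n::finite wgraph \<Rightarrow> real^'n^'n" where
  "laplacian G = degree_matrix G - adjacency_matrix G"

text \<open>Eigenvalues of the Laplacian restricted to the invariant subspace of zero-sum vectors.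
  Only their maximum and minimum are used, so multiplicities need not be recorded. The
  eigenvalue 0 still belongs to this set if the graph is disconnected.\<close>

definition disagreement_eigenvalues :: "'n::finite wgraph \<Rightarrow> real set" where
  "disagreement_eigenvalues G =
     {l. \<exists>v. v \<noteq> 0 \<and> (\<Sum>i\<in>UNIV. v $ i) = 0 \<and> laplacian G *v v = l *\<^sub>R v}"

definition lambda_max :: "'n::finite wgraph \<Rightarrow> real" where
  "lambda_max G = Max (disagreement_eigenvalues G)"

definition lambda_min :: "'n::finite wgraph \<Rightarrow> real" where
  "lambda_min G = Min (disagreement_eigenvalues G)"

definition eigenratio :: "'n::finite wgraph \<Rightarrow> real" where
  "eigenratio G = lambda_max G / lambda_min G"

definition eigenspread :: "'n::finite wgraph \<Rightarrow> real" where
  "eigenspread G = lambda_max G - lambda_min G"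

text \<open>In all that follows, \<open>P\<close> is the physical graph and \<open>C\<close> the communication graph.\<close>

definition control_input :: "'n::finite wgraph \<Rightarrow> real \<Rightarrow> real^'n \<Rightarrow> 'n \<Rightarrow> real" where
  "control_input C k y i = k * (\<Sum>j\<in>nbrs C i. weight C i j * (y $ i - y $ j))"

definition closed_loop_trajectory ::
  "real \<Rightarrow> 'n::finite wgraph \<Rightarrow> 'n wgraph \<Rightarrow> real \<Rightarrow> (nat \<Rightarrow> real^'n) \<Rightarrow> bool" where
  "closed_loop_trajectory a P C k x \<longleftrightarrow>
     (\<forall>t i. x (Suc t) $ i =
        a * x t $ i + (\<Sum>j\<in>nbrs P i. weight P i j * (x t $ j - x t $ i))
        + control_input C k (x t) i)"

text \<open>The average of the states evolves as \<open>a ^ t\<close> times its initial value for every gain,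
  so a constant consensus value can exist for all initial states only if \<open>-1 < a \<le> 1\<close>.
  For general \<open>a\<close> the common value towards which all states converge has to be a function of
  time. Both notions are defined; in either one the consensus value may depend on the initial
  state.\<close>

definition achieves_consensus ::
  "real \<Rightarrow> 'n::finite wgraph \<Rightarrow> 'n wgraph \<Rightarrow> real \<Rightarrow> bool" where
  "achieves_consensus a P C k \<longleftrightarrow>
     (\<forall>x. closed_loop_trajectory a P C k x \<longrightarrow>
        (\<exists>v :: nat \<Rightarrow> real. \<forall>i. (\<lambda>t. \<bar>x t $ i - v t\<bar>) \<longlonglongrightarrow> 0))"

definition achieves_constant_consensus ::
  "real \<Rightarrow> 'n::finite wgraph \<Rightarrow> 'n wgraph \<Rightarrow> real \<Rightarrow> bool" where
  "achieves_constant_consensus a P C k \<longleftrightarrow>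
     (\<forall>x. closed_loop_trajectory a P C k x \<longrightarrow>
        (\<exists>v :: real. \<forall>i. (\<lambda>t. \<bar>x t $ i - v\<bar>) \<longlonglongrightarrow> 0))"

definition consensusable :: "real \<Rightarrow> 'n::finite wgraph \<Rightarrow> 'n wgraph \<Rightarrow> bool" where
  "consensusable a P C \<longleftrightarrow> (\<exists>k. achieves_consensus a P C k)"

definition constant_consensusable :: "real \<Rightarrow> 'n::finite wgraph \<Rightarrow> 'n wgraph \<Rightarrow> bool" where
  "constant_consensusable a P C \<longleftrightarrow> (\<exists>k. achieves_constant_consensus a P C k)"

definition S1 :: "real \<Rightarrow> 'n::finite wgraph \<Rightarrow> 'n wgraph \<Rightarrow> bool" where
  "S1 a P C \<longleftrightarrow>
     lambda_min P > a - 1 \<and>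
     (eigenratio C - 1) * (1 - a + lambda_min P) < eigenratio C * (2 - eigenspread P)"

definition S2 :: "real \<Rightarrow> 'n::finite wgraph \<Rightarrow> 'n wgraph \<Rightarrow> bool" where
  "S2 a P C \<longleftrightarrow>
     lambda_max P < 1 + a \<and>
     (eigenratio C - 1) * (1 + a - lambda_max P) < eigenratio C * (2 - eigenspread P)"

definition K_plus :: "real \<Rightarrow> 'n::finite wgraph \<Rightarrow> 'n wgraph \<Rightarrow> real set" where
  "K_plus a P C =
     {(-1 - a + lambda_max P) / lambda_min C <..< (1 - a + lambda_min P) / lambda_max C}"

definition K_minus :: "real \<Rightarrow> 'n::finite wgraph \<Rightarrow> 'n wgraph \<Rightarrow> real set" where
  "K_minus a P C =
     {(-1 - a + lambda_max P) / lambda_max C <..< (1 - a + lambda_min P) / lambda_min C}"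

end

theory Submission
  imports Defs
begin

text \<open>On the zero-sum subspace the closed-loop map is self-adjoint, and its Rayleigh quotient
  lies between sums of the extreme Rayleigh quotients of its three terms; which extreme eigenvalue
  of the communication Laplacian enters at which end depends on the sign of the gain. Membership
  in the interval for that sign says precisely that these bounds lie strictly between -1 and 1, so
  the disagreement vector contracts geometrically. The average evolves separately, by
  multiplication with \<open>a\<close>.\<close>

section \<open>Self-adjoint maps on a subspace\<close>

text \<open>Linearity is asked globally, but invariance and symmetry only on \<open>S\<close>, so
  that the restriction to an invariant subspace can be treated without a type of its own.\<close>

definition selfadj_on :: "'a::real_inner set \<Rightarrow> ('a \<Rightarrow> 'a) \<Rightarrow> bool" where
  "selfadj_on S f \<longleftrightarrow> linear f \<and> f ` S \<subseteq> S \<and> (\<forall>u\<in>S. \<forall>v\<in>S. f u \<bullet> v = u \<bullet> f v)"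

definition eigenvalues_on :: "'a::real_vector set \<Rightarrow> ('a \<Rightarrow> 'a) \<Rightarrow> real set" where
  "eigenvalues_on S f = {l. \<exists>v\<in>S. v \<noteq> 0 \<and> f v = l *\<^sub>R v}"

lemma selfadj_onD:
  assumes "selfadj_on S f"
  shows "linear f" "v \<in> S \<Longrightarrow> f v \<in> S" "u \<in> S \<Longrightarrow> v \<in> S \<Longrightarrow> f u \<bullet> v = u \<bullet> f v"
  using assms unfolding selfadj_on_def by auto

lemma selfadj_on_uminus:
  assumes "subspace S" "selfadj_on S f"
  shows "selfadj_on S (\<lambda>x. - f x)"
  using assms unfolding selfadj_on_def
  by (auto intro!: linear_compose_neg subspace_neg)

text \<open>This is the shape of the closed-loop map; with \<open>k = 0\<close> it also covers
  \<open>l *\<^sub>R x - f x\<close>.\<close>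

lemma selfadj_on_combination:
  assumes "subspace S" "selfadj_on S f" "selfadj_on S g"
  shows "selfadj_on S (\<lambda>x. a *\<^sub>R x - f x + k *\<^sub>R g x)"
proof -
  note f = selfadj_onD[OF assms(2)] and g = selfadj_onD[OF assms(3)]
  have "linear (\<lambda>x. a *\<^sub>R x - f x + k *\<^sub>R g x)"
    by (intro linear_compose_add linear_compose_sub linear_compose_scale_right f g linear_id[unfolded id_def])
  moreover have "a *\<^sub>R x - f x + k *\<^sub>R g x \<in> S" if "x \<in> S" for x
    using that assms(1) f g by (simp add: subspace_add subspace_diff subspace_scale)
  moreover have "(a *\<^sub>R u - f u + k *\<^sub>R g u) \<bullet> v = u \<bullet> (a *\<^sub>R v - f v + k *\<^sub>R g v)"
    if "u \<in> S" "v \<in> S" for u v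
    using that f g by (simp add: inner_add_left inner_diff_left inner_add_right inner_diff_right)
  ultimately show ?thesis
    unfolding selfadj_on_def by auto
qed

text \<open>The nonnegative form attains its minimum on \<open>S\<close> at \<open>v\<close>, so its
  derivative there in the direction \<open>g v\<close>, which is
  \<open>2 * (g v \<bullet> g v)\<close>, must vanish.\<close>

lemma psd_on_isotropic_imp_kernel:
  assumes S: "subspace S" and g: "selfadj_on S g"
    and psd: "\<And>w. w \<in> S \<Longrightarrow> 0 \<le> g w \<bullet> w"
    and v: "v \<in> S" "g v \<bullet> v = 0"
  shows "g v = 0"
proof (rule ccontr)
  assume "g v \<noteq> 0"
  note g' = selfadj_onD[OF g]
  define u where "u = g v"
  define c where "c = g u \<bullet> u"
  \<comment> \<open>The quadratic \<open>2 s (u \<bullet> u) + s\<^sup>2 c\<close> is negative for small \<open>s < 0\<close>;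
    \<open>c + 1\<close> in place of \<open>c\<close> covers \<open>c = 0\<close>.\<close>
  define s where "s = - (u \<bullet> u) / (c + 1)"
  have uS: "u \<in> S" using g' v u_def by simp
  have c: "0 \<le> c" using psd uS c_def by simp
  have A: "0 < u \<bullet> u" using \<open>g v \<noteq> 0\<close> u_def by simp
  have "g (v + s *\<^sub>R u) = u + s *\<^sub>R g u"
    using linear_add[OF g'(1)] linear_scale[OF g'(1)] u_def by simp
  then have "g (v + s *\<^sub>R u) \<bullet> (v + s *\<^sub>R u) = u \<bullet> v + s * (u \<bullet> u) + s * (g u \<bullet> v) + s * s * c"
    by (simp add: inner_add_left inner_add_right c_def algebra_simps)
  also have "g u \<bullet> v = u \<bullet> u"
    using g'(3)[OF uS v(1)] u_def by simp
  also have "u \<bullet> v = 0" using v u_def by simp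
  finally have "g (v + s *\<^sub>R u) \<bullet> (v + s *\<^sub>R u) = 2 * s * (u \<bullet> u) + s * s * c" by simp
  also have "\<dots> = - ((u \<bullet> u)\<^sup>2 * (c + 2)) / (c + 1)\<^sup>2"
  proof -
    have "c + 1 \<noteq> 0" using c by linarith
    then show ?thesis
      unfolding s_def by (simp add: divide_simps power2_eq_square) (simp add: algebra_simps)
  qed
  also have "\<dots> < 0"
    using A c by (simp add: divide_neg_pos)
  finally have "g (v + s *\<^sub>R u) \<bullet> (v + s *\<^sub>R u) < 0" .
  moreover have "v + s *\<^sub>R u \<in> S" using S v uS by (simp add: subspace_add subspace_scale)
  ultimately show False using psd by fastforce
qed

section \<open>Extreme eigenvalues and Rayleigh bounds\<close>

text \<open>The quadratic form attains a maximum \<open>l\<close> on the compact unit sphere of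
  \<open>S\<close>. Then \<open>l\<close> times the identity minus \<open>f\<close> is positive
  semidefinite on \<open>S\<close> and its form vanishes at the maximizer, which is therefore an
  eigenvector.\<close>

lemma selfadj_on_max_eigenvalue:
  fixes f :: "'a::euclidean_space \<Rightarrow> 'a"
  assumes S: "subspace S" "S \<noteq> {0}" and f: "selfadj_on S f"
  obtains l where "l \<in> eigenvalues_on S f" "\<And>w. w \<in> S \<Longrightarrow> f w \<bullet> w \<le> l * (w \<bullet> w)"
proof -
  note f' = selfadj_onD[OF f]
  let ?K = "S \<inter> sphere 0 1"
  obtain w0 where w0: "w0 \<in> S" "w0 \<noteq> 0" using S subspace_0 by blast
  have "w0 /\<^sub>R norm w0 \<in> ?K" using w0 S by (simp add: subspace_scale)
  then have "?K \<noteq> {}" by blast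
  moreover have "compact ?K"
    using closed_subspace[OF S(1)] by (simp add: closed_Int_compact)
  moreover have "continuous_on ?K (\<lambda>w. f w \<bullet> w)"
    by (intro continuous_intros linear_continuous_on linear_conv_bounded_linear[THEN iffD1] f')
  ultimately obtain v where v: "v \<in> ?K" and max: "\<And>w. w \<in> ?K \<Longrightarrow> f w \<bullet> w \<le> f v \<bullet> v"
    using continuous_attains_sup[of ?K "\<lambda>w. f w \<bullet> w"] by blast
  define l where "l = f v \<bullet> v"
  have bound: "f w \<bullet> w \<le> l * (w \<bullet> w)" if "w \<in> S" for w
  proof (cases "w = 0")
    case True
    then show ?thesis using linear_0[OF f'(1)] by simp
  next
    case False
    have "w /\<^sub>R norm w \<in> ?K" using that False S by (simp add: subspace_scale)
    from max[OF this] have "(f w \<bullet> w) / (norm w)\<^sup>2 \<le> l"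
      by (simp add: l_def linear_scale[OF f'(1)] power2_eq_square divide_inverse mult_ac)
    then show ?thesis using False by (simp add: divide_le_eq power2_norm_eq_inner)
  qed
  have vS: "v \<in> S" and "norm v = 1" using v by auto
  then have vv: "v \<bullet> v = 1" by (simp add: norm_eq_1)
  have "l *\<^sub>R v - f v = 0"
  proof (rule psd_on_isotropic_imp_kernel[OF S(1) _ _ vS])
    show "selfadj_on S (\<lambda>x. l *\<^sub>R x - f x)"
      using selfadj_on_combination[OF S(1) f f, of l 0] by simp
  qed (use bound vv in \<open>auto simp: inner_diff_left l_def\<close>)
  then have "l \<in> eigenvalues_on S f"
    unfolding eigenvalues_on_def using vS vv by (auto intro!: bexI[of _ v])
  then show thesis using bound that by blast
qed

lemma selfadj_on_min_eigenvalue: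
  fixes f :: "'a::euclidean_space \<Rightarrow> 'a"
  assumes S: "subspace S" "S \<noteq> {0}" and f: "selfadj_on S f"
  obtains l where "l \<in> eigenvalues_on S f" "\<And>w. w \<in> S \<Longrightarrow> l * (w \<bullet> w) \<le> f w \<bullet> w"
proof -
  obtain l where l: "l \<in> eigenvalues_on S (\<lambda>x. - f x)"
    "\<And>w. w \<in> S \<Longrightarrow> - f w \<bullet> w \<le> l * (w \<bullet> w)"
    using selfadj_on_max_eigenvalue[OF S selfadj_on_uminus[OF S(1) f]] by blast
  have "- l \<in> eigenvalues_on S f"
    using l(1) unfolding eigenvalues_on_def by (simp add: neg_eq_iff_add_eq_0 eq_neg_iff_add_eq_0)
  moreover have "- l * (w \<bullet> w) \<le> f w \<bullet> w" if "w \<in> S" for w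
    using l(2)[OF that] by simp
  ultimately show thesis using that by blast
qed

text \<open>Eigenvectors of distinct eigenvalues are orthogonal, and a pairwise orthogonal set in a
  Euclidean space is finite. Finiteness is what gives \<open>Max\<close> and \<open>Min\<close>
  their meaning.\<close>

lemma finite_eigenvalues_on:
  fixes f :: "'a::euclidean_space \<Rightarrow> 'a"
  assumes f: "selfadj_on S f"
  shows "finite (eigenvalues_on S f)"
proof -
  let ?E = "eigenvalues_on S f"
  obtain h where h: "\<And>l. l \<in> ?E \<Longrightarrow> h l \<in> S \<and> h l \<noteq> 0 \<and> f (h l) = l *\<^sub>R h l"
    using bchoice[of ?E "\<lambda>l v. v \<in> S \<and> v \<noteq> 0 \<and> f v = l *\<^sub>R v"]
    unfolding eigenvalues_on_def by blast
  have ortho: "h l \<bullet> h m = 0" if "l \<in> ?E" "m \<in> ?E" "l \<noteq> m" for l m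
  proof -
    have "l * (h l \<bullet> h m) = m * (h l \<bullet> h m)"
      using selfadj_onD(3)[OF f, of "h l" "h m"] h that by simp
    then show ?thesis using that by simp
  qed
  \<comment> \<open>A vector chosen for two distinct eigenvalues would be orthogonal to itself,
    hence zero.\<close>
  have "inj_on h ?E"
    using ortho h by (metis inj_onI inner_eq_zero_iff)
  moreover have "finite (h ` ?E)"
  proof (rule pairwise_orthogonal_imp_finite)
    show "pairwise orthogonal (h ` ?E)"
      using ortho by (auto simp: pairwise_image pairwise_def orthogonal_def)
  qed
  ultimately show ?thesis using finite_imageD by blast
qed

text \<open>The eigenvalue \<open>l\<close> supplied by compactness lies in the finite set of
  eigenvalues, so replacing it by the extreme element only weakens the bound.\<close>

lemma selfadj_on_Rayleigh_bounds:
  fixes f :: "'a::euclidean_space \<Rightarrow> 'a"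
  assumes S: "subspace S" "S \<noteq> {0}" and f: "selfadj_on S f" and w: "w \<in> S"
  shows "Min (eigenvalues_on S f) * (w \<bullet> w) \<le> f w \<bullet> w"
    and "f w \<bullet> w \<le> Max (eigenvalues_on S f) * (w \<bullet> w)"
proof -
  obtain l where "l \<in> eigenvalues_on S f" "l * (w \<bullet> w) \<le> f w \<bullet> w"
    using selfadj_on_min_eigenvalue[OF S f] w by blast
  then show "Min (eigenvalues_on S f) * (w \<bullet> w) \<le> f w \<bullet> w"
    using Min_le[OF finite_eigenvalues_on[OF f]] mult_right_mono[OF _ inner_ge_zero] order_trans
    by meson
  obtain l where "l \<in> eigenvalues_on S f" "f w \<bullet> w \<le> l * (w \<bullet> w)"
    using selfadj_on_max_eigenvalue[OF S f] w by blast
  then show "f w \<bullet> w \<le> Max (eigenvalues_on S f) * (w \<bullet> w)"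
    using Max_ge[OF finite_eigenvalues_on[OF f]] mult_right_mono[OF _ inner_ge_zero] order_trans
    by meson
qed

section \<open>Contraction from bounds on the quadratic form\<close>

text \<open>For a symmetric map the numerical radius controls the operator norm, so bounding the
  quadratic form suffices to bound the map.\<close>

lemma selfadj_on_norm_le:
  assumes S: "subspace S" and f: "selfadj_on S f" and \<rho>: "\<rho> > 0"
    and bound: "\<And>w. w \<in> S \<Longrightarrow> \<bar>f w \<bullet> w\<bar> \<le> \<rho> * (w \<bullet> w)"
    and u: "u \<in> S"
  shows "norm (f u) \<le> \<rho> * norm u"
proof -
  note f' = selfadj_onD[OF f]
  \<comment> \<open>Polarize; the scaling of \<open>f u\<close> makes both terms of the resulting bound balance.\<close>
  define w where "w = f u /\<^sub>R \<rho>"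
  have wS: "w \<in> S" using S f' u by (simp add: w_def subspace_scale)
  have "f (u + w) \<bullet> (u + w) - f (u - w) \<bullet> (u - w) = 4 * (f u \<bullet> w)"
    using f'(3)[OF u wS]
    by (simp add: linear_add[OF f'(1)] linear_diff[OF f'(1)] inner_add_left inner_add_right
        inner_diff_left inner_diff_right inner_commute)
  moreover have "f (u + w) \<bullet> (u + w) \<le> \<rho> * ((u + w) \<bullet> (u + w))"
    "- (f (u - w) \<bullet> (u - w)) \<le> \<rho> * ((u - w) \<bullet> (u - w))"
    using bound[of "u + w"] bound[of "u - w"] S u wS by (auto simp: subspace_add subspace_diff)
  \<comment> \<open>In the sum of the two bounds the mixed terms cancel, as in the parallelogram
    law.\<close>
  ultimately have "4 * (f u \<bullet> w) \<le> \<rho> * (2 * (u \<bullet> u) + 2 * (w \<bullet> w))"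
    by (simp add: inner_add_left inner_add_right inner_diff_left inner_diff_right inner_commute
        algebra_simps)
  then have "4 * (f u \<bullet> f u) / \<rho> \<le> 2 * \<rho> * (u \<bullet> u) + 2 * (f u \<bullet> f u) / \<rho>"
    using \<rho> by (simp add: w_def field_simps)
  then have "f u \<bullet> f u \<le> \<rho>\<^sup>2 * (u \<bullet> u)"
    using \<rho> by (simp add: field_simps power2_eq_square)
  then have "(norm (f u))\<^sup>2 \<le> (\<rho> * norm u)\<^sup>2"
    by (simp add: power_mult_distrib power2_norm_eq_inner)
  then show ?thesis using \<rho> by (simp add: power2_le_iff_abs_le)
qed

text \<open>The norm estimate makes \<open>f\<close> a contraction on \<open>S\<close>, and
  invariance of \<open>S\<close> keeps all iterates where that estimate applies.\<close>

lemma selfadj_on_iterates_tendsto_0: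
  fixes z :: "nat \<Rightarrow> 'a::real_inner"
  assumes S: "subspace S" and f: "selfadj_on S f" and lo: "- 1 < lo" and hi: "hi < 1"
    and bounds: "\<And>w. w \<in> S \<Longrightarrow> lo * (w \<bullet> w) \<le> f w \<bullet> w \<and> f w \<bullet> w \<le> hi * (w \<bullet> w)"
    and z0: "z 0 \<in> S" and z: "\<And>t. z (Suc t) = f (z t)"
  shows "z \<longlonglongrightarrow> 0"
proof -
  \<comment> \<open>The entry \<open>1 / 2\<close> keeps \<rho> positive, as the norm estimate
    demands, even if \<open>- lo\<close> and \<open>hi\<close> are both nonpositive.\<close>
  define \<rho> where "\<rho> = Max {1 / 2, - lo, hi}"
  have \<rho>: "0 < \<rho>" "\<rho> < 1" "- lo \<le> \<rho>" "hi \<le> \<rho>"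
    using lo hi by (auto simp: \<rho>_def less_max_iff_disj)
  have "\<bar>f w \<bullet> w\<bar> \<le> \<rho> * (w \<bullet> w)" if "w \<in> S" for w
    using bounds[OF that] \<rho>(3,4) mult_right_mono[of "- lo" \<rho> "w \<bullet> w"]
      mult_right_mono[of hi \<rho> "w \<bullet> w"] by auto
  note contr = selfadj_on_norm_le[OF S f \<rho>(1) this]
  have zS: "z t \<in> S" for t
    by (induction t) (use z0 z selfadj_onD(2)[OF f] in auto)
  have "norm (z t) \<le> \<rho> ^ t * norm (z 0)" for t
  proof (induction t)
    case (Suc t)
    have "norm (z (Suc t)) \<le> \<rho> * norm (z t)" using contr zS z by simp
    also have "\<dots> \<le> \<rho> * (\<rho> ^ t * norm (z 0))" using Suc \<rho> by simp
    finally show ?case by simp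
  qed simp
  moreover have "(\<lambda>t. \<rho> ^ t * norm (z 0)) \<longlonglongrightarrow> 0"
    using \<rho> by (intro tendsto_mult_left_zero LIMSEQ_power_zero) auto
  ultimately show ?thesis
    by (intro Lim_null_comparison[of z "\<lambda>t. \<rho> ^ t * norm (z 0)"]) auto
qed

section \<open>Laplacians on zero-sum vectors\<close>

text \<open>This is the orthogonal complement of the all-ones vector.\<close>

definition zero_sum :: "(real^'n::finite) set" where
  "zero_sum = {v. (\<Sum>i\<in>UNIV. v $ i) = 0}"

lemma subspace_zero_sum: "subspace zero_sum"
  unfolding subspace_def zero_sum_def by (simp add: sum.distrib flip: sum_distrib_left)

text \<open>Two distinct nodes give the difference of two unit vectors, so there are eigenvalues
  over which to take extrema.\<close>

lemma zero_sum_nontrivial: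
  assumes "CARD('n::finite) \<ge> 2"
  shows "(zero_sum :: (real^'n) set) \<noteq> {0}"
proof -
  obtain i j :: 'n where ij: "i \<noteq> j"
    using assms card_le_Suc0_iff_eq[of "UNIV :: 'n set"] by fastforce
  have "axis i 1 - axis j 1 \<in> (zero_sum :: (real^'n) set)"
    by (simp add: zero_sum_def axis_def sum_subtractf)
  moreover have "axis i 1 - axis j 1 \<noteq> (0 :: real^'n)"
    using ij by (simp add: axis_eq_axis)
  ultimately show ?thesis by blast
qed

lemma disagreement_eigenvalues_eq:
  "disagreement_eigenvalues G = eigenvalues_on zero_sum ((*v) (laplacian G))"
  unfolding disagreement_eigenvalues_def eigenvalues_on_def zero_sum_def by auto

text \<open>The adjacency matrix vanishes off the edges. A summation range independent of
  \<open>i\<close> allows double sums to be swapped later.\<close>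

lemma sum_nbrs:
  "(\<Sum>j\<in>nbrs G i. weight G i j * g j) = (\<Sum>j\<in>UNIV. adjacency_matrix G $ i $ j * g j)"
  unfolding nbrs_def adjacency_matrix_def
  by (intro sum.mono_neutral_cong_left) auto

lemma laplacian_mult_nth:
  "(laplacian G *v v) $ i = (\<Sum>j\<in>UNIV. adjacency_matrix G $ i $ j * (v $ i - v $ j))"
proof -
  have "(degree_matrix G *v v) $ i = (\<Sum>j\<in>nbrs G i. weight G i j) * v $ i"
    by (simp add: degree_matrix_def matrix_vector_mult_def mult_delta_left)
  also have "\<dots> = (\<Sum>j\<in>UNIV. adjacency_matrix G $ i $ j * v $ i)"
    using sum_nbrs[of G i "\<lambda>_. v $ i"] by (simp add: sum_distrib_right)
  finally show ?thesis
    by (simp add: laplacian_def matrix_vector_mult_def sum_subtractf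
        left_diff_distrib right_diff_distrib)
qed

lemma adjacency_sym:
  "undirected_wgraph G \<Longrightarrow> adjacency_matrix G $ i $ j = adjacency_matrix G $ j $ i"
  unfolding undirected_wgraph_def adjacency_matrix_def by auto

text \<open>Swapping the indices and using symmetric weights gives a second double sum for the same
  inner product; adding both yields products of differences. Symmetry, positivity and preservation
  of the mean all follow from this form.\<close>

lemma laplacian_bilinear:
  assumes "undirected_wgraph G"
  shows "2 * ((laplacian G *v u) \<bullet> v) =
    (\<Sum>i\<in>UNIV. \<Sum>j\<in>UNIV. adjacency_matrix G $ i $ j * ((u $ i - u $ j) * (v $ i - v $ j)))"
proof -
  let ?A = "\<lambda>i j. adjacency_matrix G $ i $ j"
  have 1: "(laplacian G *v u) \<bullet> v = (\<Sum>i\<in>UNIV. \<Sum>j\<in>UNIV. ?A i j * (u $ i - u $ j) * v $ i)"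
    by (simp add: inner_vec_def laplacian_mult_nth sum_distrib_right)
  also have "\<dots> = (\<Sum>i\<in>UNIV. \<Sum>j\<in>UNIV. ?A j i * (u $ j - u $ i) * v $ j)"
    by (rule sum.swap)
  also have "\<dots> = (\<Sum>i\<in>UNIV. \<Sum>j\<in>UNIV. ?A i j * (u $ j - u $ i) * v $ j)"
    using adjacency_sym[OF assms] by simp
  finally have 2: "(laplacian G *v u) \<bullet> v = \<dots>" .
  \<comment> \<open>One copy of the inner product is expanded by \<open>1\<close>, the other by the
    swapped sum in \<open>2\<close>.\<close>
  show ?thesis
    unfolding mult_2 by (subst (1) 1, subst 2) (simp add: algebra_simps flip: sum.distrib)
qed

lemma selfadj_on_laplacian:
  assumes "undirected_wgraph G"
  shows "selfadj_on zero_sum ((*v) (laplacian G))"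
proof -
  have sym: "(laplacian G *v u) \<bullet> v = u \<bullet> (laplacian G *v v)" for u v
    using laplacian_bilinear[OF assms, of u v] laplacian_bilinear[OF assms, of v u]
    by (simp add: inner_commute mult.commute)
  \<comment> \<open>Here \<open>1\<close> is the all-ones vector. Since it is annihilated, symmetry
    makes every image orthogonal to it, which is invariance of \<open>zero_sum\<close>.\<close>
  have "laplacian G *v 1 = 0"
    by (simp add: vec_eq_iff laplacian_mult_nth)
  then have "(laplacian G *v v) \<bullet> 1 = 0" for v
    using sym[of v 1] by simp
  then have "laplacian G *v v \<in> zero_sum" for v
    by (simp add: zero_sum_def inner_vec_def)
  then show ?thesis
    using sym unfolding selfadj_on_def by auto
qed

section \<open>Extreme eigenvalues of Laplacians\<close>

lemma laplacian_Rayleigh: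
  fixes G :: "'n::finite wgraph"
  assumes "CARD('n) \<ge> 2" "undirected_wgraph G" "w \<in> zero_sum"
  shows "lambda_min G * (w \<bullet> w) \<le> (laplacian G *v w) \<bullet> w"
    and "(laplacian G *v w) \<bullet> w \<le> lambda_max G * (w \<bullet> w)"
  unfolding lambda_min_def lambda_max_def disagreement_eigenvalues_eq
  using selfadj_on_Rayleigh_bounds[OF subspace_zero_sum zero_sum_nontrivial selfadj_on_laplacian]
    assms by blast+

lemma laplacian_eigenvalues_nonempty:
  fixes G :: "'n::finite wgraph"
  assumes "CARD('n) \<ge> 2" "undirected_wgraph G"
  shows "finite (disagreement_eigenvalues G)" "disagreement_eigenvalues G \<noteq> {}"
  unfolding disagreement_eigenvalues_eq
  using finite_eigenvalues_on selfadj_on_laplacian[OF assms(2)]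
    selfadj_on_max_eigenvalue[OF subspace_zero_sum zero_sum_nontrivial] assms(1) by blast+

text \<open>If the form vanished, every edge term would vanish, so \<open>v\<close> would be
  constant along edges, hence along paths, hence everywhere; a constant vector with zero sum is
  zero.\<close>

lemma laplacian_pos:
  assumes G: "undirected_wgraph G" "connected_wgraph G" and v: "v \<in> zero_sum" "v \<noteq> 0"
  shows "0 < (laplacian G *v v) \<bullet> v"
proof (rule ccontr)
  let ?A = "\<lambda>i j. adjacency_matrix G $ i $ j"
  assume "\<not> ?thesis"
  then have le: "(\<Sum>i\<in>UNIV. \<Sum>j\<in>UNIV. ?A i j * ((v $ i - v $ j) * (v $ i - v $ j))) \<le> 0"
    using laplacian_bilinear[OF G(1), of v v] by linarith
  have nonneg: "0 \<le> ?A i j * ((v $ i - v $ j) * (v $ i - v $ j))" for i j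
    using G(1) unfolding undirected_wgraph_def adjacency_matrix_def
    by (intro mult_nonneg_nonneg[OF _ zero_le_square]) (auto intro: less_imp_le)
  have zero: "?A i j * ((v $ i - v $ j) * (v $ i - v $ j)) = 0" for i j
  proof -
    have "(\<Sum>i\<in>UNIV. \<Sum>j\<in>UNIV. ?A i j * ((v $ i - v $ j) * (v $ i - v $ j))) = 0"
      using le by (intro antisym sum_nonneg nonneg)
    then show ?thesis
      by (simp only: sum_nonneg_eq_0_iff sum_nonneg nonneg finite UNIV_I simp_thms Ball_def)
  qed
  have edge_eq: "v $ i = v $ j" if "edge G i j" for i j
  proof -
    have "0 < ?A i j" using G(1) that unfolding undirected_wgraph_def adjacency_matrix_def by auto
    then show ?thesis using zero[of i j] by simp
  qed
  have "v $ i = v $ j" if "(edge G)\<^sup>*\<^sup>* i j" for i j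
    using that by induction (auto dest: edge_eq)
  then have const: "v $ i = v $ j" for i j
    using G(2) unfolding connected_wgraph_def by blast
  then have "(\<Sum>i\<in>UNIV. v $ i) = of_nat CARD('a) * v $ j" for j
    by (simp add: sum.cong[OF refl, of UNIV "\<lambda>i. v $ i" "\<lambda>_. v $ j"])
  then show False
    using v unfolding zero_sum_def by (simp add: vec_eq_iff)
qed

text \<open>The form is evaluated at an eigenvector of the least eigenvalue. Connectedness enters
  the later arguments through this positivity, which allows the interval endpoints to be multiplied
  out.\<close>

lemma lambda_min_pos:
  fixes G :: "'n::finite wgraph"
  assumes "CARD('n) \<ge> 2" "undirected_wgraph G" "connected_wgraph G"
  shows "0 < lambda_min G"
proof -
  have "lambda_min G \<in> eigenvalues_on zero_sum ((*v) (laplacian G))"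
    using laplacian_eigenvalues_nonempty[OF assms(1,2)]
    unfolding lambda_min_def disagreement_eigenvalues_eq by (intro Min_in)
  then obtain v where v: "v \<in> zero_sum" "v \<noteq> 0" "laplacian G *v v = lambda_min G *\<^sub>R v"
    unfolding eigenvalues_on_def by blast
  have "0 < lambda_min G * (v \<bullet> v)"
    using laplacian_pos[OF assms(2,3) v(1,2)] v(3) by simp
  then show ?thesis
    by (rule zero_less_mult_pos2) (use v(2) in simp)
qed

lemma lambda_min_le_max:
  fixes G :: "'n::finite wgraph"
  assumes "CARD('n) \<ge> 2" "undirected_wgraph G"
  shows "lambda_min G \<le> lambda_max G"
  unfolding lambda_min_def lambda_max_def
  using laplacian_eigenvalues_nonempty[OF assms] by (auto simp: Min_le_iff Max_ge_iff)

section \<open>The closed loop\<close>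

lemma closed_loop_trajectory_iff:
  "closed_loop_trajectory a P C k x \<longleftrightarrow>
    (\<forall>t. x (Suc t) = a *\<^sub>R x t - laplacian P *v x t + k *\<^sub>R (laplacian C *v x t))"
proof -
  \<comment> \<open>The physical coupling uses \<open>y $ j - y $ i\<close> and the control
    \<open>y $ i - y $ j\<close>; hence the opposite signs of the two Laplacians.\<close>
  have "(\<Sum>j\<in>nbrs P i. weight P i j * (y $ j - y $ i)) = - (laplacian P *v y) $ i" for y i
    by (simp add: sum_nbrs laplacian_mult_nth flip: sum_negf mult_minus_right)
  moreover have "control_input C k y i = k * (laplacian C *v y) $ i" for y i
    by (simp add: control_input_def sum_nbrs laplacian_mult_nth)
  ultimately show ?thesis
    unfolding closed_loop_trajectory_def by (simp add: vec_eq_iff)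
qed

definition mean :: "real^'n::finite \<Rightarrow> real" where
  "mean y = (\<Sum>i\<in>UNIV. y $ i) / real CARD('n)"

text \<open>The columns of a symmetric Laplacian sum to zero, so neither the coupling nor the gain
  moves the mean.\<close>

lemma mean_closed_loop:
  assumes "undirected_wgraph P" "undirected_wgraph C" "closed_loop_trajectory a P C k x"
  shows "mean (x (Suc t)) = a * mean (x t)"
proof -
  have "(\<Sum>i\<in>UNIV. (laplacian G *v y) $ i) = 0" if "undirected_wgraph G" for G :: "'a wgraph" and y
    using laplacian_bilinear[OF that, of y 1] by (simp add: inner_vec_def)
  then show ?thesis
    using assms by (simp add: closed_loop_trajectory_iff mean_def sum.distrib sum_subtractf
        flip: sum_distrib_left)
qed

text \<open>The constants \<open>c1\<close> and \<open>c2\<close> stand for the extreme eigenvalues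
  of the communication Laplacian in either order, so that both signs of the gain are covered at
  once.\<close>

lemma closed_loop_disagreement_tendsto_0:
  fixes P C :: "'n::finite wgraph"
  assumes card: "CARD('n) \<ge> 2" and P: "undirected_wgraph P" and C: "undirected_wgraph C"
    and lo: "- 1 < a - lambda_max P + k * c1" and hi: "a - lambda_min P + k * c2 < 1"
    and c: "\<And>w. w \<in> zero_sum \<Longrightarrow> k * c1 * (w \<bullet> w) \<le> k * ((laplacian C *v w) \<bullet> w) \<and>
      k * ((laplacian C *v w) \<bullet> w) \<le> k * c2 * (w \<bullet> w)"
    and x: "closed_loop_trajectory a P C k x"
  shows "(\<lambda>t. x t $ i - mean (x t)) \<longlonglongrightarrow> 0"
proof -
  define f where "f = (\<lambda>y. a *\<^sub>R y - laplacian P *v y + k *\<^sub>R (laplacian C *v y))"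
  define z where "z = (\<lambda>t. x t - mean (x t) *\<^sub>R 1)"
  have f: "selfadj_on zero_sum f"
    unfolding f_def
    by (intro selfadj_on_combination subspace_zero_sum selfadj_on_laplacian P C)
  have xf: "x (Suc t) = f (x t)" for t
    using x by (simp add: closed_loop_trajectory_iff f_def)
  \<comment> \<open>The factor \<open>a\<close> on the all-ones vector matches that of the mean, so
    the disagreement \<open>z\<close> obeys the same recursion as \<open>x\<close>.\<close>
  have f1: "f 1 = a *\<^sub>R 1"
    by (simp add: f_def vec_eq_iff laplacian_mult_nth)
  have "z \<longlonglongrightarrow> 0"
  proof (rule selfadj_on_iterates_tendsto_0[OF subspace_zero_sum f lo hi])
    show "z 0 \<in> zero_sum"
      by (simp add: z_def zero_sum_def sum_subtractf mean_def)
    show "z (Suc t) = f (z t)" for t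
      using mean_closed_loop[OF P C x] selfadj_onD(1)[OF f]
      by (simp add: z_def xf linear_diff linear_scale f1)
    show "(a - lambda_max P + k * c1) * (w \<bullet> w) \<le> f w \<bullet> w \<and>
      f w \<bullet> w \<le> (a - lambda_min P + k * c2) * (w \<bullet> w)" if "w \<in> zero_sum" for w
      using laplacian_Rayleigh[OF card P that] c[OF that]
      by (simp add: f_def inner_add_left inner_diff_left algebra_simps)
  qed
  then have "(\<lambda>t. z t $ i) \<longlonglongrightarrow> 0 $ i" by (intro tendsto_vec_nth)
  then show ?thesis by (simp add: z_def)
qed

text \<open>Clearing the positive denominators turns membership in the interval into the two strict
  bounds; a negative gain reverses the Rayleigh inequalities and so exchanges the roles of
  \<open>lambda_min C\<close> and \<open>lambda_max C\<close>.\<close>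

lemma K_disagreement_tendsto_0:
  fixes P C :: "'n::finite wgraph"
  assumes card: "CARD('n) \<ge> 2" and P: "undirected_wgraph P" and C: "undirected_wgraph C"
    and conn: "connected_wgraph C"
    and k: "k \<in> K_plus a P C \<inter> {0..} \<union> K_minus a P C \<inter> {..<0}"
    and x: "closed_loop_trajectory a P C k x"
  shows "(\<lambda>t. x t $ i - mean (x t)) \<longlonglongrightarrow> 0"
proof -
  have pos: "0 < lambda_min C" "0 < lambda_max C"
    using lambda_min_pos[OF card C conn] lambda_min_le_max[OF card C] by auto
  from k consider "k \<in> K_plus a P C" "0 \<le> k" | "k \<in> K_minus a P C" "k < 0" by auto
  then show ?thesis
  proof cases
    case 1
    show ?thesis
    proof (rule closed_loop_disagreement_tendsto_0[OF card P C _ _ _ x])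
      show "- 1 < a - lambda_max P + k * lambda_min C" "a - lambda_min P + k * lambda_max C < 1"
        using 1 pos by (auto simp: K_plus_def field_simps)
    qed (use 1 laplacian_Rayleigh[OF card C] in \<open>auto simp: mult.assoc intro: mult_left_mono\<close>)
  next
    case 2
    show ?thesis
    proof (rule closed_loop_disagreement_tendsto_0[OF card P C _ _ _ x])
      show "- 1 < a - lambda_max P + k * lambda_max C" "a - lambda_min P + k * lambda_min C < 1"
        using 2 pos by (auto simp: K_minus_def field_simps)
    qed (use 2 laplacian_Rayleigh[OF card C] in \<open>auto simp: mult.assoc intro: mult_left_mono_neg\<close>)
  qed
qed

text \<open>The moving common value is the current mean.\<close>

lemma K_achieves_consensus:
  fixes P C :: "'n::finite wgraph"
  assumes "CARD('n) \<ge> 2" "undirected_wgraph P" "undirected_wgraph C" "connected_wgraph C"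
    and "k \<in> K_plus a P C \<inter> {0..} \<union> K_minus a P C \<inter> {..<0}"
  shows "achieves_consensus a P C k"
  unfolding achieves_consensus_def
proof (intro allI impI)
  fix x assume x: "closed_loop_trajectory a P C k x"
  show "\<exists>v. \<forall>i. (\<lambda>t. \<bar>x t $ i - v t\<bar>) \<longlonglongrightarrow> 0"
    by (intro exI[of _ "\<lambda>t. mean (x t)"] allI tendsto_rabs_zero
        K_disagreement_tendsto_0[OF assms x])
qed

lemma K_achieves_constant_consensus:
  fixes P C :: "'n::finite wgraph"
  assumes "CARD('n) \<ge> 2" and P: "undirected_wgraph P" and C: "undirected_wgraph C"
    and "connected_wgraph C"
    and "k \<in> K_plus a P C \<inter> {0..} \<union> K_minus a P C \<inter> {..<0}"
    and a: "- 1 < a" "a \<le> 1"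
  shows "achieves_constant_consensus a P C k"
  unfolding achieves_constant_consensus_def
proof (intro allI impI)
  fix x assume x: "closed_loop_trajectory a P C k x"
  have "convergent (\<lambda>t. a ^ t * mean (x 0))"
  proof (cases "a = 1")
    case False
    then have "(\<lambda>t. a ^ t) \<longlonglongrightarrow> 0" using a by (intro LIMSEQ_power_zero) auto
    then show ?thesis using tendsto_mult_left_zero convergentI by blast
  qed (simp add: convergent_const)
  moreover have "a ^ t * mean (x 0) = mean (x t)" for t
    by (induction t) (simp_all add: mean_closed_loop[OF P C x])
  ultimately obtain m where m: "(\<lambda>t. mean (x t)) \<longlonglongrightarrow> m"
    unfolding convergent_def by auto
  have "(\<lambda>t. \<bar>x t $ i - m\<bar>) \<longlonglongrightarrow> 0" for i
  proof -
    have "(\<lambda>t. (x t $ i - mean (x t)) + (mean (x t) - m)) \<longlonglongrightarrow> 0"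
      using tendsto_add[OF K_disagreement_tendsto_0[OF assms(1-5) x] LIM_zero[OF m]] by simp
    then show ?thesis using tendsto_rabs_zero by simp
  qed
  then show "\<exists>v. \<forall>i. (\<lambda>t. \<bar>x t $ i - v\<bar>) \<longlonglongrightarrow> 0" by blast
qed

section \<open>Existence of admissible gains and the final result\<close>

text \<open>Multiplied by \<open>lambda_min C\<close>, the second condition of \<open>S1\<close> is
  the cross-multiplied form of \<open>?l < ?u\<close>. The first condition gives
  \<open>0 < ?u\<close>, so a gain fits between \<open>max ?l 0\<close> and
  \<open>?u\<close>.\<close>

lemma S1_imp_K_plus_nonempty:
  assumes "S1 a P C" "0 < lambda_min C" "0 < lambda_max C"
  shows "K_plus a P C \<inter> {0..} \<noteq> {}"
proof -
  let ?l = "(-1 - a + lambda_max P) / lambda_min C" and ?u = "(1 - a + lambda_min P) / lambda_max C"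
  have "(eigenratio C - 1) * (1 - a + lambda_min P) * lambda_min C <
      eigenratio C * (2 - eigenspread P) * lambda_min C"
    using assms unfolding S1_def by (intro mult_strict_right_mono) auto
  moreover have "lambda_max C = eigenratio C * lambda_min C"
    using assms(2) by (simp add: eigenratio_def)
  ultimately have "(lambda_max C - lambda_min C) * (1 - a + lambda_min P) <
      lambda_max C * (2 - eigenspread P)"
    by (simp add: algebra_simps)
  then have "?l < ?u" "0 < ?u"
    using assms unfolding S1_def eigenspread_def by (auto simp: field_simps)
  then obtain k where "max ?l 0 < k" "k < ?u" by (meson dense max_less_iff_conj)
  then have "k \<in> K_plus a P C \<inter> {0..}" by (simp add: K_plus_def)
  then show ?thesis by blast
qed

text \<open>The same cross-multiplication gives \<open>?l < ?u\<close>; now the first condition puts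
  \<open>?l\<close> below 0, leaving room for a gain below \<open>min ?u 0\<close>.\<close>

lemma S2_imp_K_minus_nonempty:
  assumes "S2 a P C" "0 < lambda_min C" "0 < lambda_max C"
  shows "K_minus a P C \<inter> {..<0} \<noteq> {}"
proof -
  let ?l = "(-1 - a + lambda_max P) / lambda_max C" and ?u = "(1 - a + lambda_min P) / lambda_min C"
  have "(eigenratio C - 1) * (1 + a - lambda_max P) * lambda_min C <
      eigenratio C * (2 - eigenspread P) * lambda_min C"
    using assms unfolding S2_def by (intro mult_strict_right_mono) auto
  moreover have "lambda_max C = eigenratio C * lambda_min C"
    using assms(2) by (simp add: eigenratio_def)
  ultimately have "(lambda_max C - lambda_min C) * (1 + a - lambda_max P) <
      lambda_max C * (2 - eigenspread P)"
    by (simp add: algebra_simps)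
  then have "?l < ?u" "?l < 0"
    using assms unfolding S2_def eigenspread_def by (auto simp: field_simps)
  then obtain k where "?l < k" "k < min ?u 0" by (meson dense min_less_iff_conj)
  then have "k \<in> K_minus a P C \<inter> {..<0}" by (simp add: K_minus_def)
  then show ?thesis by blast
qed

text \<open>Nonemptiness of the gain sets is part of the claim, so that the choice of
  \<open>k\<close> is not vacuous. The constant version is confined to those \<open>a\<close> for
  which the mean \<open>a ^ t * mean (x 0)\<close> converges from every initial state.\<close>

theorem theorem2:
  fixes a :: real and P C :: "'n::finite wgraph"
  assumes "CARD('n) \<ge> 2"
    and "undirected_wgraph P"
    and "undirected_wgraph C"
    and "connected_wgraph C"
  shows "(S1 a P C \<or> S2 a P C \<longrightarrow> consensusable a P C) \<and>
    (S1 a P C \<longrightarrow>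
       K_plus a P C \<inter> {0..} \<noteq> {} \<and>
       (\<forall>k \<in> K_plus a P C \<inter> {0..}. achieves_consensus a P C k)) \<and>
    (S2 a P C \<longrightarrow>
       K_minus a P C \<inter> {..<0} \<noteq> {} \<and>
       (\<forall>k \<in> K_minus a P C \<inter> {..<0}. achieves_consensus a P C k)) \<and>
    (-1 < a \<and> a \<le> 1 \<longrightarrow>
       (S1 a P C \<or> S2 a P C \<longrightarrow> constant_consensusable a P C) \<and>
       (S1 a P C \<longrightarrow>
          (\<forall>k \<in> K_plus a P C \<inter> {0..}. achieves_constant_consensus a P C k)) \<and>
       (S2 a P C \<longrightarrow>
          (\<forall>k \<in> K_minus a P C \<inter> {..<0}. achieves_constant_consensus a P C k)))"
proof -
  have pos: "0 < lambda_min C" "0 < lambda_max C"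
    using lambda_min_pos lambda_min_le_max[of C] assms by fastforce+
  note consensus = K_achieves_consensus[OF assms, of _ a]
    and constant_consensus = K_achieves_constant_consensus[OF assms, of _ a]
    and nonempty = S1_imp_K_plus_nonempty[OF _ pos] S2_imp_K_minus_nonempty[OF _ pos]
  have ex: "\<exists>k. k \<in> K_plus a P C \<inter> {0..} \<union> K_minus a P C \<inter> {..<0}" if "S1 a P C \<or> S2 a P C"
    using that nonempty by blast
  show ?thesis
    unfolding consensusable_def constant_consensusable_def
    using ex nonempty consensus constant_consensus by blast
qed

end
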